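(* Let $\omega=(\omega_1,\dots,\omega_n)\in\mathbb{C}^n$, let $A=\mathrm{diag}(\omega_1,\dots,\omega_n)\in GL(n,\mathbb{C})$ be non-resonant, and let $\mathbf{f}\in V_1$. Then the equation $$\mathbf{h}={D'_\omega}^{-1}\left(\mathbf{f}\circ(\mathbf{z}+\mathbf{h})\right)$$ admits a unique solution $\mathbf{h}\in V_1$, $\mathbf{h}=\sum_{\alpha\in\mathbb{N}^n}\mathbf{h}_\alpha z^\alpha$. For $|\alpha|\ge2$ the $j$-th component of the coefficient $\mathbf{h}_\alpha$ is given by $$h_{\alpha,j}=\sum_{N=1}^{|\alpha|-1}\ \sum_{\vartheta\in\mathcal{T}_{N,\alpha,j}}\left(({\Omega'}^{-1}_{\nu_{\ell_{v_1}}}\mathbf{f}_{\alpha_{v_1}})\cdot\beta^{\ell_{v_1}}\right)\prod_{v\in\vartheta}\binom{\alpha_v}{\beta_v}\prod_{\ell_w\in L_v}\left(({\Omega'}^{-1}_{\nu_{\ell_w}}\mathbf{f}_{\alpha_w})\cdot\beta^{\ell_w}\right),$$ where $v_1$ is the root of $\vartheta$ and the last product is set equal to $1$ whenever $v$ is an end node ($L_v=\emptyset$).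
   Context: For $\alpha\in\mathbb{Z}^n$, $|\alpha|=\alpha_1+\dots+\alpha_n$ and $\omega\cdot\alpha=\sum_i\omega_i\alpha_i$; for $\alpha\in\mathbb{N}^n$, $z^\alpha=z_1^{\alpha_1}\cdots z_n^{\alpha_n}$, $\alpha!=\alpha_1!\cdots\alpha_n!$, and $\binom{\alpha}{\beta}=\frac{\alpha!}{\beta!(\alpha-\beta)!}$ if $\beta_i\le\alpha_i$ for all $i$, and $0$ otherwise. $e_j$ is the $j$-th canonical basis vector. $V=\mathbb{C}^n[[z_1,\dots,z_n]]$ is the space of formal power series $\mathbf{f}=\sum_{\alpha\in\mathbb{N}^n}\mathbf{f}_\alpha z^\alpha$, $\mathbf{f}_\alpha=(f_{\alpha,1},\dots,f_{\alpha,n})\in\mathbb{C}^n$; $v(\mathbf{f})=\inf\{|\alpha|:\mathbf{f}_\alpha\ne0\}$, $V_j=\{\mathbf{f}\in V:v(\mathbf{f})>j\}$, and $\mathbf{z}$ denotes the identity series. $A$ is resonant if there exist $\alpha\in\mathbb{Z}^n$, with all components non-negative except at most one which can assume the value $-1$, $|\alpha|\ge2$, and $j\in\{1,\dots,n\}$ such that $\omega\cdot\alpha-\omega_j=0$; otherwise non-resonant. $\Omega'_\alpha=\mathrm{diag}(\omega\cdot\alpha-\omega_1,\dots,\omega\cdot\alpha-\omega_n)$; thus $({\Omega'}_\nu^{-1}\mathbf{f}_\alpha)\cdot e_i=f_{\alpha,i}/(\omega\cdot\nu-\omega_i)$. $D'_\omega\mathbf{g}(\mathbf{z})=\sum_{\alpha\in\mathbb{N}^n}(\Omega'_\alpha\mathbf{g}_\alpha)z^\alpha$,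 which is invertible on $V_1$ when $A$ is non-resonant. Trees: $\mathcal{T}_N$ is the set of rooted trees with $N$ nodes in which the subtrees attached to each node are ordered (equivalently $\mathcal{T}_1$ consists of the single-node tree, and $\vartheta\in\mathcal{T}_N$, $N\geq 2$, is $(t,\vartheta^1,\dots,\vartheta^t)$ with $t\ge1$, $\vartheta^i\in\mathcal{T}_{N_i}$, $\sum N_i=N-1$). Each node $v$ has an exiting line $\ell_v$ (for the root $v_1$, the root line); $L_v$ is the set of lines entering $v$ (the exiting lines of its children); an end node is a node with no entering lines. Nodes are partially ordered with the root maximal: $w\le v$ iff $v$ lies on the path from the root to $w$. Labels: each node $v$ carries a label $\alpha_v\in\mathbb{N}^n$ with $|\alpha_v|\ge2$ and each line $\ell_v$ carries a label $\beta^{\ell_v}\in\mathbb{N}^n$ with $|\beta^{\ell_v}|=1$. Put $\beta_v=\sum_{\ell\in L_v}\beta^\ell$; the momentum of $\ell_v$ is $\nu_{\ell_v}=\sum_{w\le v}(\alpha_w-\beta_w)$, and the total momentum is $\nu_\vartheta=\nu_{\ell_{v_1}}$. $\mathcal{T}_{N,\alpha,j}$ is the set of labeled rooted trees of order $N$ with $\nu_\vartheta=\alpha$ and $\beta^{\ell_{v_1}}=e_j$. Summands in which some binomial $\binom{\alpha_v}{\beta_v}$ vanishes are taken to be $0$.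
   Formalization: The trees are restricted so that the subtrees at each node are ordered compatibly with their line labels (e_1-lines first, then e_2, ...); with arbitrary orderings the formula counts h^β |β|!/β! times and fails for n ≥ 2. *)

theory Defs
  imports
    "HOL-Analysis.Analysis"
    "HOL-Library.Groups_Big_Fun"
    "HOL-Library.Extended_Nat"
begin

section \<open>Multi-indices\<close>

text \<open>The index set \<open>{1,\<dots>,n}\<close> is a finite linearly ordered type \<open>'n\<close>, the basis vector
  \<open>e\<^sub>j\<close> is \<open>axis j 1\<close>, and multi-indices are vectors over \<open>nat\<close> or \<open>int\<close>.\<close>

definition msize :: "'a::comm_monoid_add ^ 'n \<Rightarrow> 'a"
  where "msize \<alpha> = (\<Sum>i\<in>UNIV. \<alpha> $ i)"

definition int_index :: "nat ^ 'n \<Rightarrow> int ^ 'n"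
  where "int_index \<alpha> = (\<chi> i. int (\<alpha> $ i))"

definition mdot :: "complex ^ 'n \<Rightarrow> int ^ 'n \<Rightarrow> complex"
  where "mdot \<omega> \<alpha> = (\<Sum>i\<in>UNIV. \<omega> $ i * of_int (\<alpha> $ i))"

definition mfact :: "nat ^ 'n \<Rightarrow> complex"
  where "mfact \<alpha> = (\<Prod>i\<in>UNIV. fact (\<alpha> $ i))"

definition mbinom :: "nat ^ 'n \<Rightarrow> nat ^ 'n \<Rightarrow> complex"
  where "mbinom \<alpha> \<beta> =
    (if \<forall>i. \<beta> $ i \<le> \<alpha> $ i then mfact \<alpha> / (mfact \<beta> * mfact (\<alpha> - \<beta>)) else 0)"


section \<open>Formal power series in several variables\<close>

typedef ('a, 'n) mfps = "UNIV :: (nat ^ 'n \<Rightarrow> 'a) set"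
  morphisms mfps_coeff Abs_mfps ..

lemma mfps_coeff_Abs [simp]: "mfps_coeff (Abs_mfps c) = c"
  by (simp add: Abs_mfps_inverse)

lemma mfps_eqI: "(\<And>\<alpha>. mfps_coeff f \<alpha> = mfps_coeff g \<alpha>) \<Longrightarrow> f = g"
  by (metis ext mfps_coeff_inject)

instantiation mfps :: (zero, finite) zero
begin
definition "0 = Abs_mfps (\<lambda>_. 0)"
instance ..
end

instantiation mfps :: (plus, finite) plus
begin
definition "f + g = Abs_mfps (\<lambda>\<alpha>. mfps_coeff f \<alpha> + mfps_coeff g \<alpha>)"
instance ..
end

instantiation mfps :: (minus, finite) minus
begin
definition "f - g = Abs_mfps (\<lambda>\<alpha>. mfps_coeff f \<alpha> - mfps_coeff g \<alpha>)"
instance ..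
end

instantiation mfps :: (uminus, finite) uminus
begin
definition "- f = Abs_mfps (\<lambda>\<alpha>. - mfps_coeff f \<alpha>)"
instance ..
end

instantiation mfps :: (zero_neq_one, finite) one
begin
definition "1 = Abs_mfps (\<lambda>\<alpha>. if \<alpha> = 0 then 1 else 0)"
instance ..
end

instantiation mfps :: ("{comm_monoid_add, times}", finite) times
begin
definition "f * g =
  Abs_mfps (\<lambda>\<gamma>. \<Sum>(\<alpha>, \<beta>) | \<alpha> + \<beta> = \<gamma>. mfps_coeff f \<alpha> * mfps_coeff g \<beta>)"
instance ..
end

lemmas mfps_arith_defs =
  zero_mfps_def plus_mfps_def minus_mfps_def uminus_mfps_def one_mfps_def times_mfps_def

lemma finite_mindex_le: "finite {\<alpha> :: nat ^ 'n. \<forall>i. \<alpha> $ i \<le> \<gamma> $ i}"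
proof (rule finite_subset)
  show "{\<alpha> :: nat ^ 'n. \<forall>i. \<alpha> $ i \<le> \<gamma> $ i} \<subseteq> vec_lambda ` (\<Pi>\<^sub>E i\<in>UNIV. {..\<gamma> $ i})"
    by (auto intro!: image_eqI[where x = "vec_nth _"] simp: PiE_iff)
  show "finite (vec_lambda ` (\<Pi>\<^sub>E i\<in>UNIV. {..\<gamma> $ i}))"
    by (intro finite_imageI finite_PiE) auto
qed

lemma finite_mindex_add: "finite {(\<alpha>, \<beta>). \<alpha> + \<beta> = (\<gamma> :: nat ^ 'n)}"
proof (rule finite_subset)
  let ?B = "{\<alpha> :: nat ^ 'n. \<forall>i. \<alpha> $ i \<le> \<gamma> $ i}"
  show "{(\<alpha>, \<beta>). \<alpha> + \<beta> = \<gamma>} \<subseteq> ?B \<times> ?B"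
    by auto
  show "finite (?B \<times> ?B)"
    by (intro finite_cartesian_product finite_mindex_le)
qed

instance mfps :: (ab_group_add, finite) ab_group_add
  by standard (auto intro!: mfps_eqI simp: mfps_arith_defs algebra_simps)

instance mfps :: (comm_ring_1, finite) comm_ring_1
proof
  fix a b c :: "('a, 'b) mfps"
  show "a * b * c = a * (b * c)"
  proof (rule mfps_eqI)
    fix \<gamma> :: "nat ^ 'b"
    have "mfps_coeff (a * b * c) \<gamma> =
        (\<Sum>p\<in>{(s, u). s + u = \<gamma>}. \<Sum>q\<in>{(x, y). x + y = fst p}.
          mfps_coeff a (fst q) * mfps_coeff b (snd q) * mfps_coeff c (snd p))"
      by (simp add: times_mfps_def sum_distrib_right case_prod_beta)
    also have "\<dots> = (\<Sum>(p, q)\<in>(SIGMA p:{(s, u). s + u = \<gamma>}. {(x, y). x + y = fst p}).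
          mfps_coeff a (fst q) * mfps_coeff b (snd q) * mfps_coeff c (snd p))"
      by (rule sum.Sigma) (use finite_mindex_add in auto)
    also have "\<dots> = (\<Sum>(p, q)\<in>(SIGMA p:{(x, s). x + s = \<gamma>}. {(y, u). y + u = snd p}).
          mfps_coeff a (fst p) * (mfps_coeff b (fst q) * mfps_coeff c (snd q)))"
      by (rule sum.reindex_bij_witness[where
            i = "\<lambda>((x, s), (y, u)). ((x + y, u), (x, y))" and
            j = "\<lambda>((s, u), (x, y)). ((x, y + u), (y, u))"])
         (auto simp: algebra_simps)
    also have "\<dots> = (\<Sum>p\<in>{(x, s). x + s = \<gamma>}. \<Sum>q\<in>{(y, u). y + u = snd p}.
          mfps_coeff a (fst p) * (mfps_coeff b (fst q) * mfps_coeff c (snd q)))"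
      by (rule sum.Sigma[symmetric]) (use finite_mindex_add in auto)
    also have "\<dots> = mfps_coeff (a * (b * c)) \<gamma>"
      by (simp add: times_mfps_def sum_distrib_left case_prod_beta)
    finally show "mfps_coeff (a * b * c) \<gamma> = mfps_coeff (a * (b * c)) \<gamma>" .
  qed
  show "a * b = b * a"
  proof (rule mfps_eqI)
    fix \<gamma> :: "nat ^ 'b"
    show "mfps_coeff (a * b) \<gamma> = mfps_coeff (b * a) \<gamma>"
      unfolding times_mfps_def mfps_coeff_Abs
      by (rule sum.reindex_bij_witness[where i = prod.swap and j = prod.swap])
         (auto simp: algebra_simps)
  qed
  show "1 * a = a"
  proof (rule mfps_eqI)
    fix \<gamma> :: "nat ^ 'b"
    have "mfps_coeff (1 * a) \<gamma> =
        (\<Sum>(\<alpha>, \<beta>)\<in>{(0 :: nat ^ 'b, \<gamma>)}. (if \<alpha> = 0 then 1 else 0) * mfps_coeff a \<beta>)"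
      unfolding times_mfps_def one_mfps_def mfps_coeff_Abs
      by (rule sum.mono_neutral_right) (use finite_mindex_add in \<open>auto split: if_splits\<close>)
    then show "mfps_coeff (1 * a) \<gamma> = mfps_coeff a \<gamma>"
      by simp
  qed
  show "(a + b) * c = a * c + b * c"
    by (rule mfps_eqI)
       (simp add: times_mfps_def plus_mfps_def algebra_simps sum.distrib case_prod_beta)
  show "(0 :: ('a, 'b) mfps) \<noteq> 1"
  proof
    assume "(0 :: ('a, 'b) mfps) = 1"
    then have "mfps_coeff (0 :: ('a, 'b) mfps) 0 = mfps_coeff (1 :: ('a, 'b) mfps) 0"
      by (rule arg_cong)
    then show False by (simp only: zero_mfps_def one_mfps_def mfps_coeff_Abs simp_thms if_True zero_neq_one)
  qed
qed

text \<open>The space \<open>V\<close> is \<open>(complex ^ 'n, 'n) mfps\<close>: series with coefficients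
  \<open>f\<^sub>\<alpha> \<in> \<complex>\<^sup>n\<close>.\<close>

definition mfps_component :: "('a ^ 'n, 'n) mfps \<Rightarrow> 'n \<Rightarrow> ('a, 'n) mfps"
  where "mfps_component f i = Abs_mfps (\<lambda>\<alpha>. mfps_coeff f \<alpha> $ i)"

definition mfps_id :: "('a::zero_neq_one ^ 'n, 'n) mfps"
  where "mfps_id = Abs_mfps (\<lambda>\<alpha>. \<chi> i. if \<alpha> = axis i 1 then 1 else 0)"

definition mfps_monom :: "('a::comm_ring_1 ^ 'n, 'n) mfps \<Rightarrow> nat ^ 'n \<Rightarrow> ('a, 'n) mfps"
  where "mfps_monom g \<alpha> = (\<Prod>i\<in>UNIV. mfps_component g i ^ (\<alpha> $ i))"

text \<open>The coefficient of \<open>z\<^sup>\<gamma>\<close> in \<open>\<Sum>\<^sub>\<alpha> f\<^sub>\<alpha> g\<^sup>\<alpha>\<close>.  If \<open>g\<close> has no constant term, then \<open>g\<^sup>\<alpha>\<close> has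
  no coefficient at \<open>\<gamma>\<close> unless \<open>\<bar>\<alpha>\<bar> \<le> \<bar>\<gamma>\<bar>\<close>, so only finitely many summands are nonzero;
  \<open>Sum_any\<close> is the sum of these.\<close>

definition mfps_compose ::
  "('a::comm_ring_1 ^ 'n, 'n) mfps \<Rightarrow> ('a ^ 'n, 'n) mfps \<Rightarrow> ('a ^ 'n, 'n) mfps"
  where "mfps_compose f g =
    Abs_mfps (\<lambda>\<gamma>. \<Sum>\<alpha>. mfps_coeff (mfps_monom g \<alpha>) \<gamma> *s mfps_coeff f \<alpha>)"

definition mfps_val :: "('a::zero, 'n::finite) mfps \<Rightarrow> enat"
  where "mfps_val f = Inf {enat (msize \<alpha>) |\<alpha>. mfps_coeff f \<alpha> \<noteq> 0}"

definition V_above :: "nat \<Rightarrow> (complex ^ 'n, 'n) mfps set"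
  where "V_above j = {f. mfps_val f > enat j}"


section \<open>Resonance and the operator \<open>D'\<^sub>\<omega>\<close>\<close>

definition diag :: "'a::zero ^ 'n \<Rightarrow> 'a ^ 'n ^ 'n"
  where "diag d = (\<chi> i j. if i = j then d $ i else 0)"

definition resonant :: "complex ^ 'n \<Rightarrow> bool"
  where "resonant \<omega> \<longleftrightarrow>
    (\<exists>\<alpha> :: int ^ 'n. (\<exists>k. \<alpha> $ k \<ge> -1 \<and> (\<forall>i. i \<noteq> k \<longrightarrow> \<alpha> $ i \<ge> 0)) \<and> msize \<alpha> \<ge> 2 \<and>
      (\<exists>j. mdot \<omega> \<alpha> - \<omega> $ j = 0))"

definition Omega :: "complex ^ 'n \<Rightarrow> int ^ 'n \<Rightarrow> complex ^ 'n ^ 'n"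
  where "Omega \<omega> \<alpha> = diag (\<chi> i. mdot \<omega> \<alpha> - \<omega> $ i)"

definition D_op :: "complex ^ 'n \<Rightarrow> (complex ^ 'n, 'n) mfps \<Rightarrow> (complex ^ 'n, 'n) mfps"
  where "D_op \<omega> g = Abs_mfps (\<lambda>\<alpha>. Omega \<omega> (int_index \<alpha>) *v mfps_coeff g \<alpha>)"

definition D_inv :: "complex ^ 'n \<Rightarrow> (complex ^ 'n, 'n) mfps \<Rightarrow> (complex ^ 'n, 'n) mfps"
  where "D_inv \<omega> = inv_into (V_above 1) (D_op \<omega>)"


section \<open>Labeled rooted trees\<close>

text \<open>A node \<open>v\<close> is represented by the subtree hanging at \<open>v\<close>, which stores the label
  \<open>\<alpha>\<^sub>v\<close> of the node, the label of its exiting line, and the ordered list of the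
  subtrees attached to it.  Hence \<open>w \<le> v\<close> means that \<open>w\<close> occurs in the list \<open>nodes v\<close>.\<close>

datatype 'n ltree =
  Node (node_label: "nat ^ 'n") (line_label: "nat ^ 'n") (children: "'n ltree list")

fun nodes :: "'n::finite ltree \<Rightarrow> 'n ltree list"
  where "nodes (Node a b ts) = Node a b ts # concat (map nodes ts)"

definition entering :: "'n ltree \<Rightarrow> nat ^ 'n"
  where "entering v = (\<Sum>w\<leftarrow>children v. line_label w)"

definition momentum :: "'n ltree \<Rightarrow> int ^ 'n"
  where "momentum v = (\<Sum>w\<leftarrow>nodes v. int_index (node_label w) - int_index (entering w))"

text \<open>The subtrees attached to a node are ordered compatibly with the labels of their lines:
  first those attached by lines labeled \<open>e\<^sub>1\<close>, then \<open>e\<^sub>2\<close>, and so on; subtrees attached by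
  equally labeled lines are in arbitrary order.  So a monomial \<open>h\<^sup>\<beta>\<close> corresponds to
  exactly one arrangement of \<open>\<bar>\<beta>\<bar>\<close> entering lines.  If every arrangement of the labels were
  allowed, \<open>h\<^sup>\<beta>\<close> would be counted \<open>\<bar>\<beta>\<bar>! / \<beta>!\<close> times.\<close>

definition label_le :: "nat ^ 'n::{finite, linorder} \<Rightarrow> nat ^ 'n::{finite, linorder} \<Rightarrow> bool"
  where "label_le \<beta> \<beta>' \<longleftrightarrow> (\<exists>i j. \<beta> = axis i 1 \<and> \<beta>' = axis j 1 \<and> i \<le> j)"

definition labeled_tree :: "'n::{finite, linorder} ltree \<Rightarrow> bool"
  where "labeled_tree \<theta> \<longleftrightarrow>
    (\<forall>v \<in> set (nodes \<theta>). msize (node_label v) \<ge> 2 \<and> msize (line_label v) = 1 \<and>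
      sorted_wrt label_le (map line_label (children v)))"

definition trees :: "nat \<Rightarrow> nat ^ 'n::{finite, linorder} \<Rightarrow> 'n \<Rightarrow> 'n ltree set"
  where "trees N \<alpha> j = {\<theta>. labeled_tree \<theta> \<and> length (nodes \<theta>) = N \<and>
    momentum \<theta> = int_index \<alpha> \<and> line_label \<theta> = axis j 1}"

text \<open>The factor attached to the line exiting from \<open>v\<close>.  For non-resonant \<open>\<omega>\<close> the matrix
  inverted here is regular whenever all binomials of the tree are nonzero; in the other
  trees the arbitrary value is multiplied by a vanishing binomial.\<close>

definition line_factor :: "complex ^ 'n \<Rightarrow> (complex ^ 'n, 'n) mfps \<Rightarrow> 'n ltree \<Rightarrow> complex"
  where "line_factor \<omega> f v =
    (\<Sum>i\<in>UNIV. (matrix_inv (Omega \<omega> (momentum v)) *v mfps_coeff f (node_label v)) $ i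
       * of_nat (line_label v $ i))"

definition tree_value :: "complex ^ 'n \<Rightarrow> (complex ^ 'n, 'n) mfps \<Rightarrow> 'n ltree \<Rightarrow> complex"
  where "tree_value \<omega> f \<theta> = line_factor \<omega> f \<theta> *
    (\<Prod>v\<leftarrow>nodes \<theta>. mbinom (node_label v) (entering v) *
       (\<Prod>w\<leftarrow>children v. line_factor \<omega> f w))"

end

theory Submission
  imports Defs "HOL-Library.Multiset"
begin

text \<open>
  Since \<open>\<omega>\<close> is nonresonant, \<open>D'\<^sub>\<omega>\<close> multiplies the coefficients of order at least two by nonzero
  numbers, so it is a bijection of \<open>V\<^sub>1\<close> (\<open>bij_betw_D_op\<close>) and the equation for \<open>h\<close> reads
  \<open>(\<omega> \<cdot> \<gamma> - \<omega>\<^sub>j) h\<^sub>\<gamma>\<^sub>,\<^sub>j = \<Sum>\<^sub>\<alpha> f\<^sub>\<alpha>\<^sub>,\<^sub>j [z\<^sup>\<gamma>] (z + h)\<^sup>\<alpha>\<close>.  Only \<open>\<alpha>\<close> with \<open>\<bar>\<alpha>\<bar> \<ge> 2\<close> occur.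

  Uniqueness: if two solutions agree below order \<open>m\<close>, then a product of at least two factors
  \<open>z\<^sub>i + h\<^sub>i\<close> changes only above order \<open>m\<close>, because every factor without difference contributes at least
  one to the order (\<open>vanish_below_prod_list_diff\<close>).  So the right hand sides agree up to order \<open>m\<close>,
  and dividing by \<open>\<omega> \<cdot> \<gamma> - \<omega>\<^sub>j\<close> the solutions do as well (\<open>solution_unique\<close>).

  Existence and the tree formula are obtained together, by checking that the tree sum is a
  solution (\<open>D_op_tree_series\<close>).  By the binomial theorem (\<open>coeff_mfps_monom_id_add\<close>),
  \<open>(z + h)\<^sup>\<alpha> = \<Sum>\<^sub>\<beta> binom \<alpha> \<beta> z\<^bsup>\<alpha> - \<beta>\<^esup> h\<^sup>\<beta>\<close>.  Choosing a term of this expansion and then a tree for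
  each factor of \<open>h\<^sup>\<beta>\<close> is the same as choosing a tree: \<open>\<alpha>\<close> is the label of the root and \<open>\<beta>\<close> the sum
  of the labels of the lines entering it (\<open>adm_trees_root\<close>).  Momentum records the exponent of
  \<open>z\<close>, the root line contributes \<open>f\<^sub>\<alpha>\<^sub>,\<^sub>j / (\<omega> \<cdot> \<gamma> - \<omega>\<^sub>j)\<close>, and the remaining factors are the binomial
  and the values of the subtrees (\<open>tree_value_Node\<close>).  As the children of a node are sorted by
  their line labels, the term \<open>h\<^sup>\<beta>\<close> corresponds to exactly one sequence of line labels, namely
  \<open>indices \<beta>\<close>.

  The correspondence concerns the trees whose binomials are all nonzero, called admissible
  below; the others contribute nothing.  Counting node and line labels gives
  \<open>\<bar>\<nu>\<bar> + N = 1 + \<Sum>\<^sub>v \<bar>\<alpha>\<^sub>v\<bar>\<close> for the total momentum \<open>\<nu>\<close> of a tree of order \<open>N\<close> (\<open>msize_momentum\<close>).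
  With \<open>\<bar>\<alpha>\<^sub>v\<bar> \<ge> 2\<close> this bounds \<open>N\<close> by \<open>\<bar>\<nu>\<bar> - 1\<close> and all labels, so the sums are finite, and it
  shows \<open>\<bar>\<nu>\<bar> \<ge> 2\<close>, so nonresonance applies to every line of an admissible tree.
\<close>

section \<open>Multi-indices\<close>

lemma msize_add: "msize (\<alpha> + \<beta>) = msize \<alpha> + msize \<beta>"
  by (simp add: msize_def sum.distrib)

lemma msize_diff: "msize (\<alpha> - \<beta>) = msize \<alpha> - msize (\<beta> :: 'a::ab_group_add ^ 'n)"
  by (simp add: msize_def sum_subtractf)

lemma msize_zero [simp]: "msize 0 = 0"
  by (simp add: msize_def)

lemma msize_axis [simp]: "msize (axis j x) = x"
  by (simp add: msize_def axis_def)

lemma msize_sum_list: "msize (sum_list as) = sum_list (map msize as)"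
  by (induction as) (simp_all add: msize_add)

lemma msize_int_index: "msize (int_index \<alpha>) = int (msize \<alpha>)"
  by (simp add: msize_def int_index_def)

lemma int_index_zero: "int_index 0 = 0"
  by (simp add: int_index_def vec_eq_iff)

lemma int_index_add: "int_index (\<alpha> + \<beta>) = int_index \<alpha> + int_index \<beta>"
  by (simp add: int_index_def vec_eq_iff)

lemma int_index_diff:
  "\<forall>i. \<beta> $ i \<le> \<alpha> $ i \<Longrightarrow> int_index (\<alpha> - \<beta>) = int_index \<alpha> - int_index \<beta>"
  by (simp add: int_index_def vec_eq_iff of_nat_diff)

lemma int_index_eq_iff: "int_index \<alpha> = int_index \<beta> \<longleftrightarrow> \<alpha> = \<beta>"
  by (simp add: int_index_def vec_eq_iff)

lemma msize_diff_nat: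
  "\<forall>i. \<beta> $ i \<le> \<alpha> $ i \<Longrightarrow> msize (\<alpha> - \<beta>) + msize \<beta> = msize (\<alpha> :: nat ^ 'n)"
  by (simp add: msize_def sum.distrib [symmetric])

lemma msize_eq_1_iff: "msize (\<beta> :: nat ^ 'n) = 1 \<longleftrightarrow> (\<exists>j. \<beta> = axis j 1)"
proof
  assume "msize \<beta> = 1"
  then obtain j where "\<beta> $ j = 1" "\<forall>i. j \<noteq> i \<longrightarrow> \<beta> $ i = 0"
    unfolding msize_def by (subst (asm) sum_eq_1_iff) auto
  then show "\<exists>j. \<beta> = axis j 1"
    by (intro exI [of _ j]) (auto simp: vec_eq_iff axis_def)
qed auto

lemma finite_msize_le: "finite {\<alpha> :: nat ^ 'n. msize \<alpha> \<le> m}"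
proof (rule finite_subset)
  show "{\<alpha> :: nat ^ 'n. msize \<alpha> \<le> m} \<subseteq> {\<alpha>. \<forall>i. \<alpha> $ i \<le> (\<chi> i. m) $ i}"
  proof clarsimp
    fix \<alpha> :: "nat ^ 'n" and i
    assume "msize \<alpha> \<le> m"
    moreover have "\<alpha> $ i \<le> msize \<alpha>"
      unfolding msize_def by (rule member_le_sum) auto
    ultimately show "\<alpha> $ i \<le> m"
      by simp
  qed
qed (rule finite_mindex_le)

text \<open>The multi-index \<open>\<beta>\<close> as a sorted list in which \<open>i\<close> occurs \<open>\<beta>\<^sub>i\<close> times.  Writing \<open>g\<^sup>\<beta>\<close> as a
  product over this list reduces statements on powers to list induction, and matches the
  ordered list of the children of a node.\<close>

definition indices :: "nat ^ 'n::{finite, linorder} \<Rightarrow> 'n list"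
  where "indices \<beta> = sorted_list_of_multiset (Abs_multiset (\<lambda>i. \<beta> $ i))"

lemma sorted_indices: "sorted (indices \<beta>)"
  by (simp add: indices_def)

lemma count_indices: "count (mset (indices \<beta>)) i = \<beta> $ i"
  by (simp add: indices_def count_Abs_multiset)

lemma sum_list_axis_nth: "(\<Sum>i\<leftarrow>js. axis i 1 :: nat ^ 'n) $ k = count (mset js) k"
  by (induction js) (auto simp: axis_def)

lemma sum_list_axis_indices: "(\<Sum>i\<leftarrow>indices \<beta>. axis i 1) = \<beta>"
  by (simp add: vec_eq_iff sum_list_axis_nth count_indices del: One_nat_def)

lemma indices_unique:
  assumes "sorted js"
  shows "indices (\<Sum>i\<leftarrow>js. axis i 1) = js"
proof -
  have "mset (indices (\<Sum>i\<leftarrow>js. axis i 1)) = mset js"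
    by (rule multiset_eqI) (simp add: count_indices sum_list_axis_nth del: One_nat_def)
  then show ?thesis
    using assms sorted_indices by (metis properties_for_sort sorted_sort_id)
qed

lemma length_indices:
  fixes \<beta> :: "nat ^ 'n::{finite, linorder}"
  shows "length (indices \<beta>) = msize \<beta>"
proof -
  have "msize \<beta> = msize (\<Sum>i\<leftarrow>indices \<beta>. axis i 1)"
    by (simp only: sum_list_axis_indices)
  also have "\<dots> = length (indices \<beta>)"
    by (simp add: msize_sum_list o_def sum_list_triv)
  finally show ?thesis ..
qed

lemma prod_list_indices:
  "prod_list (map g (indices \<beta>)) = (\<Prod>i\<in>UNIV. (g i :: 'a::comm_monoid_mult) ^ (\<beta> $ i))"
proof -
  have "prod_list (map g js) = (\<Prod>i\<in>UNIV. g i ^ count (mset js) i)" for js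
  proof (induction js)
    case (Cons j js)
    have "(\<Prod>i\<in>UNIV. g i ^ count (mset (j # js)) i) =
        (\<Prod>i\<in>UNIV. (if i = j then g i else 1) * g i ^ count (mset js) i)"
      by (rule prod.cong) auto
    then show ?case
      using Cons by (simp add: prod.distrib)
  qed simp
  then show ?thesis
    by (simp add: count_indices)
qed

section \<open>Power series\<close>

lemma coeff_zero [simp]: "mfps_coeff 0 \<gamma> = 0"
  by (simp add: zero_mfps_def)

lemma coeff_add: "mfps_coeff (F + G) \<gamma> = mfps_coeff F \<gamma> + mfps_coeff G \<gamma>"
  by (simp add: plus_mfps_def)

lemma coeff_diff: "mfps_coeff (F - G) \<gamma> = mfps_coeff F \<gamma> - mfps_coeff G \<gamma>"
  by (simp add: minus_mfps_def)

lemma coeff_mult: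
  "mfps_coeff (F * G) \<gamma> = (\<Sum>(\<alpha>, \<beta>) | \<alpha> + \<beta> = \<gamma>. mfps_coeff F \<alpha> * mfps_coeff G \<beta>)"
  by (simp add: times_mfps_def)

lemma coeff_one: "mfps_coeff 1 \<gamma> = (if \<gamma> = 0 then 1 else 0)"
  by (simp add: one_mfps_def)

lemma coeff_sum:
  "mfps_coeff (sum F S :: ('a::ab_group_add, 'n::finite) mfps) \<gamma> = (\<Sum>x\<in>S. mfps_coeff (F x) \<gamma>)"
  by (induction S rule: infinite_finite_induct) (simp_all add: coeff_add)

lemma coeff_of_nat_mult:
  "mfps_coeff (of_nat k * F :: ('a::comm_ring_1, 'n::finite) mfps) \<gamma> = of_nat k * mfps_coeff F \<gamma>"
  by (induction k) (simp_all add: coeff_add algebra_simps)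

lemma coeff_component: "mfps_coeff (mfps_component g i) \<gamma> = mfps_coeff g \<gamma> $ i"
  by (simp add: mfps_component_def)

lemma component_add: "mfps_component (g + h) i = mfps_component g i + mfps_component h i"
  by (rule mfps_eqI) (simp add: coeff_component coeff_add)

lemma mfps_monom_list:
  "mfps_monom g \<beta> = prod_list (map (mfps_component g) (indices \<beta>))"
  by (simp add: mfps_monom_def prod_list_indices)

definition zpow :: "nat ^ 'n \<Rightarrow> ('a::zero_neq_one, 'n) mfps"
  where "zpow \<delta> = Abs_mfps (\<lambda>\<gamma>. if \<gamma> = \<delta> then 1 else 0)"

lemma coeff_zpow: "mfps_coeff (zpow \<delta>) \<gamma> = (if \<gamma> = \<delta> then 1 else 0)"
  by (simp add: zpow_def)

lemma coeff_zpow_mult: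
  "mfps_coeff (zpow \<delta> * F :: ('a::comm_ring_1, 'n::finite) mfps) \<gamma> =
    (\<Sum>\<epsilon> | \<delta> + \<epsilon> = \<gamma>. mfps_coeff F \<epsilon>)"
proof -
  have "mfps_coeff (zpow \<delta> * F) \<gamma> =
      (\<Sum>(\<alpha>, \<beta>)\<in>Pair \<delta> ` {\<epsilon>. \<delta> + \<epsilon> = \<gamma>}. mfps_coeff (zpow \<delta>) \<alpha> * mfps_coeff F \<beta>)"
    unfolding coeff_mult
    by (rule sum.mono_neutral_right) (auto simp: coeff_zpow finite_mindex_add)
  then show ?thesis
    by (simp add: sum.reindex inj_on_def coeff_zpow)
qed

lemma zpow_add: "zpow \<delta> * zpow \<epsilon> = (zpow (\<delta> + \<epsilon>) :: ('a::comm_ring_1, 'n::finite) mfps)"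
proof (rule mfps_eqI)
  fix \<gamma> :: "nat ^ 'n"
  have "{\<epsilon>'. \<delta> + \<epsilon>' = \<gamma>} \<subseteq> snd ` {(\<alpha>, \<beta>). \<alpha> + \<beta> = \<gamma>}"
    by force
  then have "finite {\<epsilon>'. \<delta> + \<epsilon>' = \<gamma>}"
    by (rule finite_subset) (intro finite_imageI finite_mindex_add)
  then show "mfps_coeff (zpow \<delta> * zpow \<epsilon>) \<gamma> = (mfps_coeff (zpow (\<delta> + \<epsilon>)) \<gamma> :: 'a)"
    by (auto simp: coeff_zpow_mult coeff_zpow)
qed

lemma mfps_monom_id:
  "mfps_monom (mfps_id :: ('a::comm_ring_1 ^ 'n::{finite, linorder}, 'n) mfps) \<beta> = zpow \<beta>"
proof -
  have comp: "mfps_component mfps_id i = (zpow (axis i 1) :: ('a, 'n) mfps)" for i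
    by (rule mfps_eqI) (simp add: coeff_component mfps_id_def coeff_zpow)
  have "prod_list (map (\<lambda>i. zpow (axis i 1)) js) = (zpow (\<Sum>i\<leftarrow>js. axis i 1) :: ('a, 'n) mfps)" for js
    by (induction js) (auto intro!: mfps_eqI simp: zpow_add coeff_one coeff_zpow)
  then show ?thesis
    using sum_list_axis_indices [of \<beta>] by (simp add: mfps_monom_list comp cong: map_cong)
qed

text \<open>The multivariate binomial theorem: apply the binomial theorem to each of the factors
  \<open>(h\<^sub>i + z\<^sub>i)\<^bsup>\<alpha>\<^sub>i\<^esup>\<close> and multiply out.\<close>

lemma mfps_monom_id_add:
  fixes h :: "('a::comm_ring_1 ^ 'n::{finite, linorder}, 'n) mfps"
    and \<alpha> :: "nat ^ 'n::{finite, linorder}"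
  shows "mfps_monom (mfps_id + h) \<alpha> =
    (\<Sum>\<beta> | \<forall>i. \<beta> $ i \<le> \<alpha> $ i.
       of_nat (\<Prod>i\<in>UNIV. \<alpha> $ i choose \<beta> $ i) * (zpow (\<alpha> - \<beta>) * mfps_monom h \<beta>))"
proof -
  let ?z = "mfps_component mfps_id :: 'n \<Rightarrow> ('a, 'n) mfps"
  let ?h = "mfps_component h"
  have "mfps_monom (mfps_id + h) \<alpha> = (\<Prod>i\<in>UNIV. (?h i + ?z i) ^ (\<alpha> $ i))"
    by (simp add: mfps_monom_def component_add add.commute)
  also have "\<dots> = (\<Prod>i\<in>UNIV. \<Sum>k\<le>\<alpha> $ i. of_nat (\<alpha> $ i choose k) * ?h i ^ k * ?z i ^ (\<alpha> $ i - k))"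
    by (simp add: binomial_ring)
  also have "\<dots> = (\<Sum>\<phi>\<in>(\<Pi>\<^sub>E i\<in>UNIV. {..\<alpha> $ i}). \<Prod>i\<in>UNIV.
      of_nat (\<alpha> $ i choose \<phi> i) * ?h i ^ \<phi> i * ?z i ^ (\<alpha> $ i - \<phi> i))"
    by (rule prod_sum_PiE) auto
  also have "\<dots> = (\<Sum>\<beta> | \<forall>i. \<beta> $ i \<le> \<alpha> $ i. \<Prod>i\<in>UNIV.
      of_nat (\<alpha> $ i choose \<beta> $ i) * ?h i ^ (\<beta> $ i) * ?z i ^ (\<alpha> $ i - \<beta> $ i))"
    by (rule sum.reindex_bij_witness [where i = vec_nth and j = vec_lambda]) (auto simp: PiE_iff)
  also have "\<dots> = (\<Sum>\<beta> | \<forall>i. \<beta> $ i \<le> \<alpha> $ i.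
      of_nat (\<Prod>i\<in>UNIV. \<alpha> $ i choose \<beta> $ i) * (zpow (\<alpha> - \<beta>) * mfps_monom h \<beta>))"
    by (simp add: mfps_monom_id [symmetric] mfps_monom_def prod.distrib of_nat_prod mult_ac)
  finally show ?thesis .
qed

lemma mbinom_eq_prod:
  assumes "\<forall>i. \<beta> $ i \<le> \<alpha> $ i"
  shows "mbinom \<alpha> \<beta> = of_nat (\<Prod>i\<in>UNIV. \<alpha> $ i choose \<beta> $ i)"
proof -
  have "mbinom \<alpha> \<beta> =
      (\<Prod>i\<in>UNIV. fact (\<alpha> $ i) / (fact (\<beta> $ i) * fact (\<alpha> $ i - \<beta> $ i)))"
    using assms by (simp add: mbinom_def mfact_def prod.distrib prod_dividef)
  also have "\<dots> = (\<Prod>i\<in>UNIV. of_nat (\<alpha> $ i choose \<beta> $ i))"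
    by (rule prod.cong) (use assms in \<open>simp_all add: binomial_fact\<close>)
  finally show ?thesis
    by simp
qed

text \<open>The inner sum has at most one term, the multi-index \<open>\<gamma> - (\<alpha> - \<beta>)\<close> if it is nonnegative.  Keeping
  it as a sum avoids truncated subtraction, and \<open>\<epsilon>\<close> becomes the total momentum of the subtrees
  below a root.\<close>

lemma coeff_mfps_monom_id_add:
  fixes h :: "(complex ^ 'n::{finite, linorder}, 'n) mfps"
  shows "mfps_coeff (mfps_monom (mfps_id + h) \<alpha>) \<gamma> =
    (\<Sum>\<beta> | \<forall>i. \<beta> $ i \<le> \<alpha> $ i. mbinom \<alpha> \<beta> *
       (\<Sum>\<epsilon> | \<alpha> - \<beta> + \<epsilon> = \<gamma>. mfps_coeff (mfps_monom h \<beta>) \<epsilon>))"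
  by (simp add: mfps_monom_id_add coeff_sum coeff_of_nat_mult coeff_zpow_mult mbinom_eq_prod
      del: of_nat_prod)

section \<open>The filtration by order\<close>

definition vanish_below :: "nat \<Rightarrow> ('a::zero, 'n::finite) mfps \<Rightarrow> bool"
  where "vanish_below m F \<longleftrightarrow> (\<forall>\<gamma>. msize \<gamma> < m \<longrightarrow> mfps_coeff F \<gamma> = 0)"

lemma V_above_iff: "f \<in> V_above j \<longleftrightarrow> vanish_below (Suc j) f"
proof
  assume "f \<in> V_above j"
  then have j: "enat j < mfps_val f"
    by (simp add: V_above_def)
  have "mfps_val f \<le> enat (msize \<gamma>)" if "mfps_coeff f \<gamma> \<noteq> 0" for \<gamma>
    unfolding mfps_val_def using that by (intro Inf_lower) auto
  with j show "vanish_below (Suc j) f"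
    unfolding vanish_below_def by (metis enat_ord_simps(2) less_Suc_eq_le linorder_not_less order_less_le_trans)
next
  assume "vanish_below (Suc j) f"
  then have "enat (Suc j) \<le> mfps_val f"
    unfolding mfps_val_def vanish_below_def by (intro Inf_greatest) (auto simp: not_less [symmetric])
  then show "f \<in> V_above j"
    unfolding V_above_def by (simp add: Suc_ile_eq)
qed

lemma vanish_below_add: "vanish_below m F \<Longrightarrow> vanish_below m G \<Longrightarrow>
    vanish_below m (F + G :: ('a::comm_monoid_add, 'n::finite) mfps)"
  by (simp add: vanish_below_def coeff_add)

lemma vanish_below_mult:
  fixes F G :: "('a::comm_ring_1, 'n::finite) mfps"
  assumes "vanish_below k F" and "vanish_below l G"
  shows "vanish_below (k + l) (F * G)"
  unfolding vanish_below_def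
proof (intro allI impI)
  fix \<gamma> :: "nat ^ 'n"
  assume "msize \<gamma> < k + l"
  have "mfps_coeff F \<alpha> * mfps_coeff G \<beta> = 0" if "\<alpha> + \<beta> = \<gamma>" for \<alpha> \<beta>
  proof -
    have "msize \<alpha> < k \<or> msize \<beta> < l"
      using \<open>msize \<gamma> < k + l\<close> that [symmetric] by (simp add: msize_add) linarith
    then show ?thesis
      using assms by (auto simp: vanish_below_def)
  qed
  then show "mfps_coeff (F * G) \<gamma> = 0"
    unfolding coeff_mult by (intro sum.neutral) auto
qed

lemma vanish_below_prod_list:
  fixes F :: "'b \<Rightarrow> ('a::comm_ring_1, 'n::finite) mfps"
  assumes "\<And>j. vanish_below k (F j)"
  shows "vanish_below (k * length js) (prod_list (map F js))"
proof (induction js)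
  case Nil
  show ?case by (simp add: vanish_below_def)
next
  case (Cons j js)
  then show ?case
    using vanish_below_mult [OF assms] by simp
qed

text \<open>Telescoping \<open>F P - G Q = (F - G) P + G (P - Q)\<close>: each summand of the complete expansion has one
  factor \<open>F\<^sub>j - G\<^sub>j\<close> of order at least \<open>m\<close> and \<open>length js - 1\<close> other factors of order at least one.\<close>

lemma vanish_below_prod_list_diff:
  fixes F G :: "'b \<Rightarrow> ('a::comm_ring_1, 'n::finite) mfps"
  assumes F: "\<And>j. vanish_below 1 (F j)" and G: "\<And>j. vanish_below 1 (G j)"
    and FG: "\<And>j. vanish_below m (F j - G j)" and "m \<ge> 1"
  shows "vanish_below (m + length js - 1) (prod_list (map F js) - prod_list (map G js))"
proof (induction js)
  case Nil
  show ?case by (simp add: vanish_below_def)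
next
  case (Cons j js)
  let ?P = "prod_list (map F js)" and ?Q = "prod_list (map G js)"
  have "vanish_below (m + length js) ((F j - G j) * ?P)"
    using vanish_below_mult [OF FG vanish_below_prod_list [of 1 F js, OF F]] by simp
  moreover have "vanish_below (m + length js) (G j * (?P - ?Q))"
    using vanish_below_mult [OF G Cons] \<open>m \<ge> 1\<close> by simp
  ultimately have "vanish_below (m + length js) ((F j - G j) * ?P + G j * (?P - ?Q))"
    by (rule vanish_below_add)
  then show ?case
    by (simp add: algebra_simps)
qed

section \<open>Labeled trees\<close>

lemma label_le_axis: "label_le (axis i 1) (axis j 1) \<longleftrightarrow> i \<le> j"
  by (auto simp: label_le_def axis_eq_axis)

text \<open>The labeling and sorting conditions on the entering lines leave exactly one sequence of labels
  for each value of their sum.\<close>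

lemma sorted_labels_iff:
  "(\<forall>b\<in>set bs. msize b = 1) \<and> sorted_wrt label_le bs \<longleftrightarrow>
    bs = map (\<lambda>i. axis i 1) (indices (sum_list bs))"
proof
  assume bs: "(\<forall>b\<in>set bs. msize b = 1) \<and> sorted_wrt label_le bs"
  then obtain js where js: "bs = map (\<lambda>i. axis i 1) js"
    by (metis ex_map_conv msize_eq_1_iff)
  with bs have "sorted js"
    by (simp add: sorted_wrt_map label_le_axis del: One_nat_def)
  then show "bs = map (\<lambda>i. axis i 1) (indices (sum_list bs))"
    using indices_unique js by metis
next
  assume bs: "bs = map (\<lambda>i. axis i 1) (indices (sum_list bs))"
  have "sorted_wrt label_le (map (\<lambda>i. axis i 1) (indices (sum_list bs)))"
    by (simp add: sorted_wrt_map label_le_axis sorted_indices del: One_nat_def)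
  moreover have "\<forall>b\<in>set (map (\<lambda>i. axis i 1) (indices (sum_list bs))). msize b = 1"
    by simp
  ultimately show "(\<forall>b\<in>set bs. msize b = 1) \<and> sorted_wrt label_le bs"
    using bs by metis
qed

lemma length_nodes_pos: "length (nodes \<theta>) \<ge> 1"
  by (cases \<theta>) simp

lemma entering_Node: "entering (Node a b ts) = sum_list (map line_label ts)"
  by (simp add: entering_def)

lemma labeled_tree_Node:
  "labeled_tree (Node a b ts) \<longleftrightarrow> msize a \<ge> 2 \<and> msize b = 1 \<and>
    sorted_wrt label_le (map line_label ts) \<and> (\<forall>t\<in>set ts. labeled_tree t)"
  by (auto simp: labeled_tree_def)

lemma labeled_tree_line_label: "labeled_tree \<theta> \<Longrightarrow> msize (line_label \<theta>) = 1"
  by (cases \<theta>) (simp add: labeled_tree_Node)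

lemma momentum_Node:
  "momentum (Node a b ts) =
    int_index a - int_index (sum_list (map line_label ts)) + sum_list (map momentum ts)"
proof -
  have "(\<Sum>v\<leftarrow>concat (map nodes ts). int_index (node_label v) - int_index (entering v)) =
      sum_list (map momentum ts)"
    by (induction ts) (simp_all add: momentum_def)
  then show ?thesis
    by (simp add: momentum_def entering_Node)
qed

text \<open>Every node except the root contributes its exiting line, a label of size one, to the \<open>\<beta>\<^sub>v\<close> of
  its parent, so the sizes of all \<open>\<beta>\<^sub>v\<close> add up to the number of nodes minus one.\<close>

lemma msize_momentum:
  "labeled_tree \<theta> \<Longrightarrow> msize (momentum \<theta>) + int (length (nodes \<theta>)) =
    1 + (\<Sum>v\<leftarrow>nodes \<theta>. int (msize (node_label v)))"
proof (induction \<theta>)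
  case (Node a b ts)
  have "msize (sum_list (map line_label us)) = length us \<and>
      msize (sum_list (map momentum us)) + int (length (concat (map nodes us))) =
      int (length us) + (\<Sum>v\<leftarrow>concat (map nodes us). int (msize (node_label v)))"
    if "set us \<subseteq> set ts" for us
    using that
  proof (induction us)
    case (Cons t us)
    then have "labeled_tree t"
      using Node.prems by (auto simp: labeled_tree_Node)
    then show ?case
      using Cons Node.IH [of t] labeled_tree_line_label [of t] by (simp add: msize_add)
  qed simp
  from this [of ts] show ?case
    by (simp add: momentum_Node msize_add msize_diff msize_int_index)
qed

lemma msize_momentum_ge:
  assumes "labeled_tree \<theta>"
  shows "int (length (nodes \<theta>)) + 1 \<le> msize (momentum \<theta>)"
proof -
  have "(\<Sum>v\<leftarrow>nodes \<theta>. 2) \<le> (\<Sum>v\<leftarrow>nodes \<theta>. int (msize (node_label v)))"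
    using assms by (intro sum_list_mono) (fastforce simp: labeled_tree_def)
  then show ?thesis
    using msize_momentum [OF assms] by (simp add: sum_list_triv)
qed

lemma msize_node_label_le:
  assumes "labeled_tree \<theta>" and "v \<in> set (nodes \<theta>)"
  shows "int (msize (node_label v)) \<le> msize (momentum \<theta>) + int (length (nodes \<theta>))"
proof -
  have "int (msize (node_label v)) \<le> (\<Sum>v\<leftarrow>nodes \<theta>. int (msize (node_label v)))"
    using assms(2) by (intro member_le_sum_list) auto
  then show ?thesis
    using msize_momentum [OF assms(1)] by simp
qed

text \<open>A tree of order at most \<open>N + 1\<close> is a root with two labels and at most \<open>N\<close> subtrees of order at
  most \<open>N\<close>.\<close>

lemma finite_trees_bounded:
  assumes "finite A" and "finite B"
  shows "finite {\<theta>. length (nodes \<theta>) \<le> N \<and>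
    (\<forall>v\<in>set (nodes \<theta>). node_label v \<in> A \<and> line_label v \<in> B)}" (is "finite (?S N)")
proof (induction N)
  case 0
  have "?S 0 = {}"
    using length_nodes_pos by (metis (no_types, lifting) Collect_empty_eq not_one_le_zero order_trans)
  then show ?case
    by simp
next
  case (Suc N)
  let ?L = "{ts. set ts \<subseteq> ?S N \<and> length ts \<le> N}"
  have "?S (Suc N) \<subseteq> (\<lambda>(a, b, ts). Node a b ts) ` (A \<times> B \<times> ?L)"
  proof
    fix \<theta> assume \<theta>: "\<theta> \<in> ?S (Suc N)"
    obtain a b ts where [simp]: "\<theta> = Node a b ts"
      by (cases \<theta>)
    have len: "length (concat (map nodes ts)) \<le> N"
      using \<theta> by simp
    have "length ts = (\<Sum>t\<leftarrow>ts. 1)"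
      by (simp add: sum_list_triv)
    also have "\<dots> \<le> (\<Sum>t\<leftarrow>ts. length (nodes t))"
      by (intro sum_list_mono length_nodes_pos)
    finally have "length ts \<le> N"
      using len by (simp add: length_concat o_def)
    moreover have "length (nodes t) \<le> N" if "t \<in> set ts" for t
    proof -
      have "length (nodes t) \<le> (\<Sum>t\<leftarrow>ts. length (nodes t))"
        using that by (intro member_le_sum_list) auto
      then show ?thesis
        using len by (simp add: length_concat o_def)
    qed
    ultimately show "\<theta> \<in> (\<lambda>(a, b, ts). Node a b ts) ` (A \<times> B \<times> ?L)"
      using \<theta> by (intro image_eqI [of _ _ "(a, b, ts)"]) auto
  qed
  moreover have "finite (A \<times> B \<times> ?L)"
    using assms Suc.IH by (intro finite_cartesian_product finite_lists_length_le)
  ultimately show ?case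
    by (rule finite_surj [rotated])
qed

text \<open>This covers the trees with vanishing binomials too: a sum over an infinite set would be zero
  irrespective of its nonzero terms.\<close>

lemma finite_trees: "finite (trees N \<alpha> j)"
proof (rule finite_subset)
  let ?A = "{a. msize a \<le> msize \<alpha> + N}" and ?B = "{b. msize b \<le> 1}"
  show "trees N \<alpha> j \<subseteq> {\<theta>. length (nodes \<theta>) \<le> N \<and>
      (\<forall>v\<in>set (nodes \<theta>). node_label v \<in> ?A \<and> line_label v \<in> ?B)}"
  proof
    fix \<theta> assume \<theta>: "\<theta> \<in> trees N \<alpha> j"
    have "msize (node_label v) \<le> msize \<alpha> + N" if "v \<in> set (nodes \<theta>)" for v
      using msize_node_label_le [OF _ that] \<theta> by (simp add: trees_def msize_int_index)
    with \<theta> show "\<theta> \<in> {\<theta>. length (nodes \<theta>) \<le> N \<and>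
        (\<forall>v\<in>set (nodes \<theta>). node_label v \<in> ?A \<and> line_label v \<in> ?B)}"
      by (simp add: trees_def labeled_tree_def)
  qed
  show "finite {\<theta>. length (nodes \<theta>) \<le> N \<and>
      (\<forall>v\<in>set (nodes \<theta>). node_label v \<in> ?A \<and> line_label v \<in> ?B)}"
    by (intro finite_trees_bounded finite_msize_le)
qed

section \<open>Trees with nonvanishing binomials\<close>

definition admissible :: "'n::finite ltree \<Rightarrow> bool"
  where "admissible \<theta> \<longleftrightarrow> (\<forall>v\<in>set (nodes \<theta>). \<forall>i. entering v $ i \<le> node_label v $ i)"

lemma admissible_Node:
  "admissible (Node a b ts) \<longleftrightarrow>
    (\<forall>i. sum_list (map line_label ts) $ i \<le> a $ i) \<and> (\<forall>t\<in>set ts. admissible t)"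
  by (auto simp: admissible_def entering_Node)

text \<open>The inverse of \<open>int_index\<close> on nonnegative vectors.  It reads off the exponents of \<open>z\<close> from the
  momenta, which are nonnegative for admissible trees because each \<open>\<alpha>\<^sub>v - \<beta>\<^sub>v\<close> is.\<close>

definition nat_index :: "int ^ 'n \<Rightarrow> nat ^ 'n"
  where "nat_index v = (\<chi> i. nat (v $ i))"

lemma nat_index_int_index [simp]: "nat_index (int_index \<alpha>) = \<alpha>"
  by (simp add: nat_index_def int_index_def vec_eq_iff)

lemma int_nat_momentum:
  assumes "admissible \<theta>"
  shows "int_index (nat_index (momentum \<theta>)) = momentum \<theta>"
proof -
  have "(\<Sum>v\<leftarrow>vs. int_index (node_label v) - int_index (entering v)) =
      int_index (\<Sum>v\<leftarrow>vs. node_label v - entering v)"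
    if "set vs \<subseteq> set (nodes \<theta>)" for vs
    using that assms
    by (induction vs) (auto simp: int_index_zero int_index_add int_index_diff admissible_def)
  then have "momentum \<theta> = int_index (\<Sum>v\<leftarrow>nodes \<theta>. node_label v - entering v)"
    by (simp add: momentum_def)
  then show ?thesis
    by simp
qed

lemma int_nat_momenta:
  assumes "\<forall>t\<in>set ts. admissible t"
  shows "int_index (nat_index (sum_list (map momentum ts))) = sum_list (map momentum ts)"
proof -
  have "sum_list (map momentum ts) = int_index (\<Sum>t\<leftarrow>ts. nat_index (momentum t))"
    using assms by (induction ts) (auto simp: int_index_zero int_index_add int_nat_momentum)
  then show ?thesis
    by simp
qed

definition adm_trees :: "nat ^ 'n::{finite, linorder} \<Rightarrow> 'n \<Rightarrow> 'n ltree set"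
  where "adm_trees \<delta> j = {\<theta>. labeled_tree \<theta> \<and> admissible \<theta> \<and>
    momentum \<theta> = int_index \<delta> \<and> line_label \<theta> = axis j 1}"

text \<open>The sequences of subtrees contributing to the coefficient of \<open>z\<^sup>\<delta>\<close> in the product of the series
  \<open>h\<^sub>i\<close>, \<open>i\<close> ranging over \<open>js\<close>.\<close>

definition adm_forests :: "nat ^ 'n::{finite, linorder} \<Rightarrow> 'n list \<Rightarrow> 'n ltree list set"
  where "adm_forests \<delta> js = {ts. (\<forall>t\<in>set ts. labeled_tree t \<and> admissible t) \<and>
    sum_list (map momentum ts) = int_index \<delta> \<and> map line_label ts = map (\<lambda>i. axis i 1) js}"

lemma adm_forests_line_labels:
  "ts \<in> adm_forests \<delta> (indices \<beta>) \<Longrightarrow> sum_list (map line_label ts) = \<beta>"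
  by (simp add: adm_forests_def sum_list_axis_indices del: One_nat_def)

lemma adm_trees_length:
  assumes "\<theta> \<in> adm_trees \<delta> j"
  shows "length (nodes \<theta>) + 1 \<le> msize \<delta>"
  using assms msize_momentum_ge [of \<theta>] by (simp add: adm_trees_def msize_int_index)

lemma adm_trees_empty: "msize \<delta> < 2 \<Longrightarrow> adm_trees \<delta> j = {}"
  using adm_trees_length [of _ \<delta> j] length_nodes_pos
  by (metis add_le_cancel_right equals0I not_less one_add_one order_trans)

lemma adm_trees_subset: "adm_trees \<delta> j \<subseteq> (\<Union>N\<in>{1..msize \<delta> - 1}. trees N \<delta> j)"
proof
  fix \<theta> assume \<theta>: "\<theta> \<in> adm_trees \<delta> j"
  have "length (nodes \<theta>) \<in> {1..msize \<delta> - 1}"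
    using adm_trees_length [OF \<theta>] length_nodes_pos [of \<theta>] by simp
  with \<theta> show "\<theta> \<in> (\<Union>N\<in>{1..msize \<delta> - 1}. trees N \<delta> j)"
    by (auto simp: adm_trees_def trees_def)
qed

lemma finite_adm_trees: "finite (adm_trees \<delta> j)"
  by (rule finite_subset [OF adm_trees_subset]) (simp add: finite_trees)

lemma adm_forests_Nil: "adm_forests \<delta> [] = (if \<delta> = 0 then {[]} else {})"
  by (auto simp: adm_forests_def int_index_eq_iff [symmetric] int_index_zero)

text \<open>This is the convolution formula for the coefficients of a product, on the level of trees:
  the first tree takes the part \<open>\<delta>\<^sub>1\<close> of the momentum and the other trees take \<open>\<delta>\<^sub>2\<close>.\<close>

lemma adm_forests_Cons:
  fixes \<delta> :: "nat ^ 'n::{finite, linorder}" and j :: 'n and js :: "'n list"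
  defines "S \<equiv> SIGMA p:{(\<delta>\<^sub>1, \<delta>\<^sub>2). \<delta>\<^sub>1 + \<delta>\<^sub>2 = \<delta>}. adm_trees (fst p) j \<times> adm_forests (snd p) js"
  shows "bij_betw (\<lambda>(_, t, ts). t # ts) S (adm_forests \<delta> (j # js))"
  by (rule bij_betw_byWitness [where f' =
        "\<lambda>ts. ((nat_index (momentum (hd ts)), nat_index (sum_list (map momentum (tl ts)))), hd ts, tl ts)"])
     (auto simp: S_def adm_trees_def adm_forests_def int_index_add int_nat_momentum int_nat_momenta
       int_index_eq_iff [symmetric] Cons_eq_map_conv map_eq_Cons_conv)

lemma finite_adm_forests: "finite (adm_forests \<delta> js)"
proof (induction js arbitrary: \<delta>)
  case Nil
  show ?case by (simp add: adm_forests_Nil)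
next
  case (Cons j js)
  show ?case
    using bij_betw_finite [OF adm_forests_Cons [of \<delta> j js]] Cons
    by (auto simp: finite_adm_trees finite_mindex_add intro!: finite_SigmaI)
qed

lemma adm_forests_msize:
  assumes "ts \<in> adm_forests \<delta> js"
  shows "2 * length js \<le> msize \<delta>"
proof -
  have "2 * int (length ts) \<le> msize (sum_list (map momentum ts))"
    if "\<forall>t\<in>set ts. labeled_tree t" for ts :: "'a ltree list"
    using that
  proof (induction ts)
    case (Cons t ts)
    then show ?case
      using msize_momentum_ge [of t] length_nodes_pos [of t] by (simp add: msize_add)
  qed simp
  from this [of ts] have "2 * length ts \<le> msize \<delta>"
    using assms by (simp add: adm_forests_def msize_int_index)
  moreover have "length ts = length js"
    using assms map_eq_imp_length_eq by (auto simp: adm_forests_def)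
  ultimately show ?thesis
    by simp
qed

lemma coeff_prod_list_adm_forests:
  fixes F :: "'n::{finite, linorder} \<Rightarrow> ('a::comm_ring_1, 'n) mfps"
  assumes "\<And>\<delta> j. mfps_coeff (F j) \<delta> = (\<Sum>\<theta>\<in>adm_trees \<delta> j. w \<theta>)"
  shows "mfps_coeff (prod_list (map F js)) \<delta> = (\<Sum>ts\<in>adm_forests \<delta> js. prod_list (map w ts))"
proof (induction js arbitrary: \<delta>)
  case Nil
  show ?case by (simp add: adm_forests_Nil coeff_one)
next
  case (Cons j js)
  let ?P = "{(\<delta>\<^sub>1, \<delta>\<^sub>2). \<delta>\<^sub>1 + \<delta>\<^sub>2 = \<delta>}"
  have "mfps_coeff (prod_list (map F (j # js))) \<delta> =
      (\<Sum>(\<delta>\<^sub>1, \<delta>\<^sub>2)\<in>?P. \<Sum>(t, ts)\<in>adm_trees \<delta>\<^sub>1 j \<times> adm_forests \<delta>\<^sub>2 js. w t * prod_list (map w ts))"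
    by (simp add: coeff_mult assms Cons sum_product sum.cartesian_product)
  also have "\<dots> = (\<Sum>p\<in>?P. \<Sum>(t, ts)\<in>adm_trees (fst p) j \<times> adm_forests (snd p) js.
      prod_list (map w (t # ts)))"
    by (simp add: case_prod_beta)
  also have "\<dots> = (\<Sum>(p, t, ts)\<in>(SIGMA p:?P. adm_trees (fst p) j \<times> adm_forests (snd p) js).
      prod_list (map w (t # ts)))"
    by (subst sum.Sigma)
       (auto simp: finite_mindex_add finite_adm_trees finite_adm_forests case_prod_beta)
  also have "\<dots> = (\<Sum>ts\<in>adm_forests \<delta> (j # js). prod_list (map w ts))"
    using sum.reindex_bij_betw [OF adm_forests_Cons [of \<delta> j js], of "\<lambda>ts. prod_list (map w ts)"]
    by (simp add: case_prod_beta)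
  finally show ?case .
qed

text \<open>A tree is determined by its root label \<open>a\<close> and its sequence of subtrees; \<open>\<beta>\<close> and \<open>\<epsilon>\<close> are the sum of
  the line labels and the total momentum of that sequence.  The bound \<open>\<bar>a\<bar> \<le> \<bar>\<gamma>\<bar>\<close> holds because each of the
  \<open>\<bar>\<beta>\<bar>\<close> subtrees has momentum of size at least two, so \<open>\<bar>\<gamma>\<bar> = \<bar>a\<bar> - \<bar>\<beta>\<bar> + \<bar>\<epsilon>\<bar> \<ge> \<bar>a\<bar> + \<bar>\<beta>\<bar>\<close>.\<close>

lemma adm_trees_root:
  fixes \<gamma> :: "nat ^ 'n::{finite, linorder}"
  defines "S \<equiv> SIGMA a:{a. 2 \<le> msize a \<and> msize a \<le> msize \<gamma>}. SIGMA \<beta>:{\<beta>. \<forall>i. \<beta> $ i \<le> a $ i}.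
    SIGMA \<epsilon>:{\<epsilon>. a - \<beta> + \<epsilon> = \<gamma>}. adm_forests \<epsilon> (indices \<beta>)"
  shows "bij_betw (\<lambda>(a, \<beta>, \<epsilon>, ts). Node a (axis j 1) ts) S (adm_trees \<gamma> j)"
proof (rule bij_betw_byWitness [where f' = "\<lambda>\<theta>. (node_label \<theta>, sum_list (map line_label (children \<theta>)),
      nat_index (sum_list (map momentum (children \<theta>))), children \<theta>)"])
  show "\<forall>x\<in>S. (\<lambda>\<theta>. (node_label \<theta>, sum_list (map line_label (children \<theta>)),
      nat_index (sum_list (map momentum (children \<theta>))), children \<theta>))
      ((\<lambda>(a, \<beta>, \<epsilon>, ts). Node a (axis j 1) ts) x) = x"
    by (auto simp: S_def adm_forests_def sum_list_axis_indices simp del: One_nat_def)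
  show "\<forall>\<theta>\<in>adm_trees \<gamma> j. (\<lambda>(a, \<beta>, \<epsilon>, ts). Node a (axis j 1) ts)
      (node_label \<theta>, sum_list (map line_label (children \<theta>)),
      nat_index (sum_list (map momentum (children \<theta>))), children \<theta>) = \<theta>"
    by (auto simp: adm_trees_def simp flip: One_nat_def) (metis ltree.collapse)
  show "(\<lambda>(a, \<beta>, \<epsilon>, ts). Node a (axis j 1) ts) ` S \<subseteq> adm_trees \<gamma> j"
  proof clarify
    fix a \<beta> \<epsilon> ts
    assume "(a, \<beta>, \<epsilon>, ts) \<in> S"
    then have a: "2 \<le> msize a" and \<beta>: "\<forall>i. \<beta> $ i \<le> a $ i" and \<epsilon>: "a - \<beta> + \<epsilon> = \<gamma>"
      and ts: "\<forall>t\<in>set ts. labeled_tree t \<and> admissible t" "sum_list (map momentum ts) = int_index \<epsilon>"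
        "map line_label ts = map (\<lambda>i. axis i 1) (indices \<beta>)"
      by (auto simp: S_def adm_forests_def)
    have lab: "sum_list (map line_label ts) = \<beta>"
      by (simp only: ts(3) sum_list_axis_indices)
    then have "sorted_wrt label_le (map line_label ts)"
      using ts(3) sorted_labels_iff by metis
    moreover have "momentum (Node a (axis j 1) ts) = int_index \<gamma>"
      by (simp add: momentum_Node lab ts(2) \<epsilon> [symmetric] int_index_add int_index_diff [OF \<beta>])
    ultimately show "Node a (axis j 1) ts \<in> adm_trees \<gamma> j"
      using a \<beta> ts(1) by (simp add: adm_trees_def labeled_tree_Node admissible_Node lab)
  qed
  show "(\<lambda>\<theta>. (node_label \<theta>, sum_list (map line_label (children \<theta>)),
      nat_index (sum_list (map momentum (children \<theta>))), children \<theta>)) ` adm_trees \<gamma> j \<subseteq> S"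
  proof clarify
    fix \<theta> assume \<theta>: "\<theta> \<in> adm_trees \<gamma> j"
    obtain a b ts where N: "\<theta> = Node a b ts"
      by (cases \<theta>)
    let ?\<beta> = "sum_list (map line_label ts)" and ?\<epsilon> = "nat_index (sum_list (map momentum ts))"
    have a: "2 \<le> msize a" and \<beta>: "\<forall>i. ?\<beta> $ i \<le> a $ i"
      and ts: "\<forall>t\<in>set ts. labeled_tree t \<and> admissible t" "sorted_wrt label_le (map line_label ts)"
      using \<theta> by (auto simp: N adm_trees_def labeled_tree_Node admissible_Node)
    have lab: "map line_label ts = map (\<lambda>i. axis i 1) (indices ?\<beta>)"
      using sorted_labels_iff [of "map line_label ts"] ts labeled_tree_line_label by auto
    have mom: "int_index ?\<epsilon> = sum_list (map momentum ts)"
      using ts(1) by (intro int_nat_momenta) auto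
    have "int_index (a - ?\<beta> + ?\<epsilon>) = int_index \<gamma>"
      using \<theta> by (simp add: N adm_trees_def momentum_Node int_index_add int_index_diff [OF \<beta>] mom)
    then have \<epsilon>: "a - ?\<beta> + ?\<epsilon> = \<gamma>"
      by (simp add: int_index_eq_iff)
    have forest: "ts \<in> adm_forests ?\<epsilon> (indices ?\<beta>)"
      using ts(1) lab mom by (simp add: adm_forests_def)
    have "msize a \<le> msize \<gamma>"
      using msize_diff_nat [OF \<beta>] adm_forests_msize [OF forest] \<epsilon> [symmetric]
      by (simp add: length_indices msize_add)
    then show "(node_label \<theta>, sum_list (map line_label (children \<theta>)),
        nat_index (sum_list (map momentum (children \<theta>))), children \<theta>) \<in> S"
      using a \<beta> \<epsilon> forest by (simp add: S_def N)
  qed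
qed

lemma sum_adm_trees_root:
  fixes \<gamma> :: "nat ^ 'n::{finite, linorder}"
  shows "(\<Sum>\<theta>\<in>adm_trees \<gamma> j. G \<theta>) =
    (\<Sum>a | 2 \<le> msize a \<and> msize a \<le> msize \<gamma>. \<Sum>\<beta> | \<forall>i. \<beta> $ i \<le> a $ i.
       \<Sum>\<epsilon> | a - \<beta> + \<epsilon> = \<gamma>. \<Sum>ts\<in>adm_forests \<epsilon> (indices \<beta>). G (Node a (axis j 1) ts))"
proof -
  have fin: "finite {\<epsilon>. \<delta> + \<epsilon> = \<gamma>}" for \<delta> :: "nat ^ 'n::{finite, linorder}"
    by (rule finite_subset [OF _ finite_mindex_le [of \<gamma>]]) auto
  have fin': "finite {a :: nat ^ 'n::{finite, linorder}. 2 \<le> msize a \<and> msize a \<le> msize \<gamma>}"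
    by (rule finite_subset [OF _ finite_msize_le]) auto
  show ?thesis
    by (subst sum.reindex_bij_betw [OF adm_trees_root, symmetric])
       (simp add: sum.Sigma fin fin' finite_mindex_le finite_adm_forests finite_SigmaI case_prod_beta)
qed

section \<open>Values of trees\<close>

text \<open>Attributing the factor of each line to the node below it instead of the node above it turns
  the defining product into a recursion over the subtrees.\<close>

lemma tree_value_Node:
  "tree_value \<omega> f (Node a b ts) =
    line_factor \<omega> f (Node a b ts) * mbinom a (sum_list (map line_label ts)) *
      prod_list (map (tree_value \<omega> f) ts)"
proof -
  have "(\<Prod>w\<leftarrow>ts. line_factor \<omega> f w) *
      (\<Prod>v\<leftarrow>concat (map nodes ts). mbinom (node_label v) (entering v) *
        (\<Prod>w\<leftarrow>children v. line_factor \<omega> f w)) = prod_list (map (tree_value \<omega> f) ts)"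
    by (induction ts) (simp_all add: tree_value_def mult_ac)
  then show ?thesis
    by (simp add: tree_value_def [of _ _ "Node a b ts"] entering_Node mult_ac)
qed

lemma tree_value_not_admissible:
  assumes "\<not> admissible \<theta>"
  shows "tree_value \<omega> f \<theta> = 0"
proof -
  obtain v where "v \<in> set (nodes \<theta>)" "\<not> (\<forall>i. entering v $ i \<le> node_label v $ i)"
    using assms unfolding admissible_def by blast
  then have "v \<in> set (nodes \<theta>)" "mbinom (node_label v) (entering v) = 0"
    by (simp_all only: mbinom_def if_False)
  then have "0 \<in> set (map (\<lambda>v. mbinom (node_label v) (entering v) *
      (\<Prod>w\<leftarrow>children v. line_factor \<omega> f w)) (nodes \<theta>))"
    by force
  then show ?thesis
    unfolding tree_value_def by (metis mult_zero_right prod_list_zero_iff)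
qed

lemma sum_tree_value:
  "(\<Sum>N = 1..msize \<gamma> - 1. \<Sum>\<theta>\<in>trees N \<gamma> j. tree_value \<omega> f \<theta>) =
    (\<Sum>\<theta>\<in>adm_trees \<gamma> j. tree_value \<omega> f \<theta>)"
proof -
  have "(\<Sum>N = 1..msize \<gamma> - 1. \<Sum>\<theta>\<in>trees N \<gamma> j. tree_value \<omega> f \<theta>) =
      (\<Sum>\<theta>\<in>(\<Union>N\<in>{1..msize \<gamma> - 1}. trees N \<gamma> j). tree_value \<omega> f \<theta>)"
    by (rule sum.UNION_disjoint [symmetric]) (auto simp: finite_trees, auto simp: trees_def)
  also have "\<dots> = (\<Sum>\<theta>\<in>adm_trees \<gamma> j. tree_value \<omega> f \<theta>)"
  proof (rule sum.mono_neutral_right)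
    show "\<forall>\<theta>\<in>(\<Union>N\<in>{1..msize \<gamma> - 1}. trees N \<gamma> j) - adm_trees \<gamma> j. tree_value \<omega> f \<theta> = 0"
      using tree_value_not_admissible by (auto simp: trees_def adm_trees_def)
  qed (use adm_trees_subset finite_trees in auto)
  finally show ?thesis .
qed

section \<open>Diagonal matrices and nonresonance\<close>

lemma diag_mult_vec: "(diag d *v x) $ i = d $ i * (x $ i :: 'a::semiring_1)"
  by (simp add: matrix_vector_mult_def diag_def if_distrib [of "\<lambda>c. c * _"] cong: if_cong)

lemma diag_mult_diag: "diag d ** diag e = diag (\<chi> i. d $ i * (e $ i :: 'a::semiring_1))"
  by (auto simp: matrix_matrix_mult_def diag_def vec_eq_iff if_distrib [of "\<lambda>c. c * _"]
      cong: if_cong)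

lemma matrix_inv_diag_mult_vec:
  fixes d x :: "'a::field ^ 'n"
  assumes "\<forall>i. d $ i \<noteq> 0"
  shows "(matrix_inv (diag d) *v x) $ i = x $ i / d $ i"
proof -
  let ?E = "diag (\<chi> i. inverse (d $ i))" and ?B = "matrix_inv (diag d)"
  have one: "diag (\<chi> i. 1) = (mat 1 :: 'a ^ 'n ^ 'n)"
    by (simp add: diag_def mat_def vec_eq_iff)
  have E: "diag d ** ?E = mat 1" "?E ** diag d = mat 1"
    using assms by (simp_all add: diag_mult_diag one)
  then have "\<exists>B. diag d ** B = mat 1 \<and> B ** diag d = mat 1"
    by blast
  then have "?B ** diag d = mat 1"
    unfolding matrix_inv_def by (rule someI2_ex) simp
  then have "?B = ?E"
    using E(1) by (metis matrix_mul_assoc matrix_mul_lid matrix_mul_rid)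
  then show ?thesis
    by (simp add: diag_mult_vec field_simps)
qed

lemma nonresonant_divisor:
  assumes "\<not> resonant \<omega>" and "msize \<gamma> \<ge> 2"
  shows "mdot \<omega> (int_index \<gamma>) - \<omega> $ i \<noteq> 0"
proof
  assume "mdot \<omega> (int_index \<gamma>) - \<omega> $ i = 0"
  moreover have "\<exists>k. int_index \<gamma> $ k \<ge> -1 \<and> (\<forall>i. i \<noteq> k \<longrightarrow> int_index \<gamma> $ i \<ge> 0)"
    by (simp add: int_index_def)
  moreover have "msize (int_index \<gamma>) \<ge> 2"
    using assms(2) by (simp add: msize_int_index)
  ultimately show False
    using assms(1) unfolding resonant_def by blast
qed

lemma coeff_D_op:
  "mfps_coeff (D_op \<omega> h) \<gamma> $ i = (mdot \<omega> (int_index \<gamma>) - \<omega> $ i) * mfps_coeff h \<gamma> $ i"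
  by (simp add: D_op_def Omega_def diag_mult_vec)

lemma bij_betw_D_op:
  assumes "\<not> resonant \<omega>"
  shows "bij_betw (D_op \<omega>) (V_above 1) (V_above 1)"
proof (rule bij_betw_byWitness [where f' = "\<lambda>g. Abs_mfps (\<lambda>\<gamma>. \<chi> i.
      if msize \<gamma> < 2 then 0 else mfps_coeff g \<gamma> $ i / (mdot \<omega> (int_index \<gamma>) - \<omega> $ i))"])
qed (use nonresonant_divisor [OF assms] in
    \<open>auto intro!: mfps_eqI simp: V_above_iff vanish_below_def vec_eq_iff coeff_D_op\<close>)

lemma eq_D_inv_iff:
  assumes "\<not> resonant \<omega>" and "h \<in> V_above 1" and "g \<in> V_above 1"
  shows "h = D_inv \<omega> g \<longleftrightarrow> D_op \<omega> h = g"
  using bij_betw_D_op [OF assms(1)] assms(2,3) unfolding D_inv_def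
  by (metis bij_betw_inv_into_left bij_betw_inv_into_right)

lemma line_factor_axis:
  assumes "\<not> resonant \<omega>" and "msize \<gamma> \<ge> 2" and "\<theta> \<in> adm_trees \<gamma> j"
  shows "line_factor \<omega> f \<theta> =
    mfps_coeff f (node_label \<theta>) $ j / (mdot \<omega> (int_index \<gamma>) - \<omega> $ j)"
proof -
  have "(matrix_inv (Omega \<omega> (int_index \<gamma>)) *v x) $ i = x $ i / (mdot \<omega> (int_index \<gamma>) - \<omega> $ i)"
    for x i
    using nonresonant_divisor [OF assms(1,2)] by (simp add: Omega_def matrix_inv_diag_mult_vec)
  moreover have "momentum \<theta> = int_index \<gamma>" "line_label \<theta> = axis j 1"
    using assms(3) by (simp_all add: adm_trees_def)
  ultimately show ?thesis
    by (simp add: line_factor_def axis_def if_distrib [of "\<lambda>c. _ * of_nat c"] cong: if_cong)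
qed

section \<open>Existence and uniqueness\<close>

lemma vanish_below_mono: "vanish_below m F \<Longrightarrow> k \<le> m \<Longrightarrow> vanish_below k F"
  by (simp add: vanish_below_def)

lemma vanish_below_id_add:
  fixes h :: "('a::comm_ring_1 ^ 'n, 'n::finite) mfps"
  assumes "vanish_below 1 h"
  shows "vanish_below 1 (mfps_component (mfps_id + h) i)"
  using assms by (auto simp: vanish_below_def coeff_component coeff_add mfps_id_def)

text \<open>The terms with \<open>\<bar>a\<bar> < 2\<close> vanish because of \<open>f\<close>, those with \<open>\<bar>a\<bar> > \<bar>\<gamma>\<bar>\<close> because each of the \<open>\<bar>a\<bar>\<close> factors
  of \<open>(z + h)\<^sup>a\<close> has order at least one.  The remaining range is that of the root labels in
  \<open>adm_trees_root\<close>.\<close>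

lemma coeff_compose:
  fixes f h :: "(complex ^ 'n::{finite, linorder}, 'n) mfps"
  assumes f: "vanish_below 2 f" and h: "vanish_below 1 h"
  shows "mfps_coeff (mfps_compose f (mfps_id + h)) \<gamma> $ j =
    (\<Sum>a | 2 \<le> msize a \<and> msize a \<le> msize \<gamma>.
      mfps_coeff (mfps_monom (mfps_id + h) a) \<gamma> * mfps_coeff f a $ j)"
proof -
  let ?A = "{a :: nat ^ 'n::{finite, linorder}. 2 \<le> msize a \<and> msize a \<le> msize \<gamma>}"
  have "mfps_coeff (mfps_monom (mfps_id + h) a) \<gamma> = 0" if "msize \<gamma> < msize a" for a
    using vanish_below_prod_list [of 1 "mfps_component (mfps_id + h)" "indices a",
        OF vanish_below_id_add [OF h]] that
    by (simp add: mfps_monom_list vanish_below_def length_indices)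
  moreover have "mfps_coeff f a = 0" if "msize a < 2" for a
    using f that by (simp add: vanish_below_def)
  ultimately have "{a. mfps_coeff (mfps_monom (mfps_id + h) a) \<gamma> *s mfps_coeff f a \<noteq> 0} \<subseteq> ?A"
    by (force simp: not_less [symmetric])
  moreover have "finite ?A"
    by (rule finite_subset [OF _ finite_msize_le]) auto
  ultimately show ?thesis
    by (simp add: mfps_compose_def Sum_any.expand_superset [of ?A])
qed

lemma compose_in_V_above:
  fixes f h :: "(complex ^ 'n::{finite, linorder}, 'n) mfps"
  assumes "vanish_below 2 f" and "vanish_below 1 h"
  shows "vanish_below 2 (mfps_compose f (mfps_id + h))"
  using coeff_compose [OF assms] unfolding vanish_below_def
  by (auto simp: vec_eq_iff intro!: sum.neutral)

text \<open>Induction on the order up to which the two solutions agree.  Gaining one order needs \<open>\<bar>a\<bar> \<ge> 2\<close>, that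
  is, the absence of linear terms in \<open>f\<close>.\<close>

lemma solution_unique:
  fixes f h h' :: "(complex ^ 'n::{finite, linorder}, 'n) mfps"
  assumes nonres: "\<not> resonant \<omega>" and f: "vanish_below 2 f"
    and h: "vanish_below 2 h" "D_op \<omega> h = mfps_compose f (mfps_id + h)"
    and h': "vanish_below 2 h'" "D_op \<omega> h' = mfps_compose f (mfps_id + h')"
  shows "h = h'"
proof -
  note h1 = vanish_below_mono [OF h(1), of 1, simplified]
    vanish_below_mono [OF h'(1), of 1, simplified]
  have "vanish_below m (h - h')" for m
  proof (induction m)
    case 0
    show ?case by (simp add: vanish_below_def)
  next
    case (Suc m)
    have "mfps_coeff h \<gamma> $ j = mfps_coeff h' \<gamma> $ j" if "msize \<gamma> = m" for \<gamma> j
    proof (cases "m < 2")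
      case True
      then show ?thesis
        using h(1) h'(1) that by (simp add: vanish_below_def)
    next
      case False
      have "mfps_coeff (mfps_monom (mfps_id + h) a) \<gamma> = mfps_coeff (mfps_monom (mfps_id + h') a) \<gamma>"
        if "2 \<le> msize a" for a
      proof -
        let ?F = "mfps_component (mfps_id + h)" and ?G = "mfps_component (mfps_id + h')"
        have "vanish_below m (?F i - ?G i)" for i
          using Suc by (simp add: vanish_below_def coeff_component coeff_add coeff_diff)
        then have "vanish_below (m + length (indices a) - 1)
            (prod_list (map ?F (indices a)) - prod_list (map ?G (indices a)))"
          using False h1 by (intro vanish_below_prod_list_diff vanish_below_id_add) auto
        then have "vanish_below (m + 1) (mfps_monom (mfps_id + h) a - mfps_monom (mfps_id + h') a)"
          unfolding mfps_monom_list
          by (rule vanish_below_mono) (use that in \<open>simp add: length_indices\<close>)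
        then show ?thesis
          using \<open>msize \<gamma> = m\<close> by (simp add: vanish_below_def coeff_diff)
      qed
      then have "mfps_coeff (D_op \<omega> h) \<gamma> $ j = mfps_coeff (D_op \<omega> h') \<gamma> $ j"
        unfolding h(2) h'(2) using h1 by (simp add: coeff_compose [OF f])
      then show ?thesis
        using nonresonant_divisor [OF nonres, of \<gamma> j] that False by (simp add: coeff_D_op)
    qed
    then show ?case
      using Suc by (auto simp: vanish_below_def coeff_diff less_Suc_eq vec_eq_iff)
  qed
  then show ?thesis
    by (intro mfps_eqI) (auto simp: vanish_below_def coeff_diff)
qed

definition tree_series ::
  "complex ^ 'n::{finite, linorder} \<Rightarrow> (complex ^ 'n::{finite, linorder}, 'n) mfps \<Rightarrow>
    (complex ^ 'n::{finite, linorder}, 'n) mfps"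
  where "tree_series \<omega> f = Abs_mfps (\<lambda>\<gamma>. \<chi> j. \<Sum>\<theta>\<in>adm_trees \<gamma> j. tree_value \<omega> f \<theta>)"

lemma coeff_tree_series:
  "mfps_coeff (tree_series \<omega> f) \<gamma> $ j = (\<Sum>\<theta>\<in>adm_trees \<gamma> j. tree_value \<omega> f \<theta>)"
  by (simp add: tree_series_def)

lemma vanish_below_tree_series: "vanish_below 2 (tree_series \<omega> f)"
  by (simp add: vanish_below_def vec_eq_iff coeff_tree_series adm_trees_empty)

text \<open>Multiplication by \<open>\<omega> \<cdot> \<gamma> - \<omega>\<^sub>j\<close> removes the divisor of the root line; the decomposition at the
  root then produces the binomial expansion of \<open>f \<circ> (z + h)\<close> term by term.\<close>

lemma D_op_tree_series:
  fixes f :: "(complex ^ 'n::{finite, linorder}, 'n) mfps"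
  assumes nonres: "\<not> resonant \<omega>" and f: "vanish_below 2 f"
  shows "D_op \<omega> (tree_series \<omega> f) = mfps_compose f (mfps_id + tree_series \<omega> f)"
proof -
  let ?H = "tree_series \<omega> f" and ?val = "tree_value \<omega> f"
  have H1: "vanish_below 1 ?H"
    by (rule vanish_below_mono [OF vanish_below_tree_series]) simp
  \<comment> \<open>Sequences of trees with labels \<open>indices \<beta>\<close> expand the power \<open>h\<^sup>\<beta>\<close>.\<close>
  have powers: "mfps_coeff (mfps_monom ?H \<beta>) \<epsilon> =
      (\<Sum>ts\<in>adm_forests \<epsilon> (indices \<beta>). prod_list (map ?val ts))" for \<beta> \<epsilon>
    unfolding mfps_monom_list
    by (rule coeff_prod_list_adm_forests) (simp add: coeff_component coeff_tree_series)
  have "mfps_coeff (D_op \<omega> ?H) \<gamma> $ j = mfps_coeff (mfps_compose f (mfps_id + ?H)) \<gamma> $ j" for \<gamma> j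
  proof (cases "msize \<gamma> < 2")
    case True
    then show ?thesis
      using compose_in_V_above [OF f H1] vanish_below_tree_series [of \<omega> f]
      by (simp add: coeff_D_op vanish_below_def)
  next
    case False
    let ?d = "mdot \<omega> (int_index \<gamma>) - \<omega> $ j"
    let ?sub = "\<lambda>\<theta>. mbinom (node_label \<theta>) (sum_list (map line_label (children \<theta>))) *
      prod_list (map ?val (children \<theta>))"
    have "?d * ?val \<theta> = mfps_coeff f (node_label \<theta>) $ j * ?sub \<theta>" if "\<theta> \<in> adm_trees \<gamma> j" for \<theta>
      using line_factor_axis [OF nonres _ that, of f] nonresonant_divisor [OF nonres, of \<gamma> j] False
      by (cases \<theta>) (simp add: tree_value_Node)
    then have "mfps_coeff (D_op \<omega> ?H) \<gamma> $ j =
        (\<Sum>\<theta>\<in>adm_trees \<gamma> j. mfps_coeff f (node_label \<theta>) $ j * ?sub \<theta>)"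
      by (simp add: coeff_D_op coeff_tree_series sum_distrib_left)
    also have "\<dots> = (\<Sum>a | 2 \<le> msize a \<and> msize a \<le> msize \<gamma>. \<Sum>\<beta> | \<forall>i. \<beta> $ i \<le> a $ i.
        \<Sum>\<epsilon> | a - \<beta> + \<epsilon> = \<gamma>. \<Sum>ts\<in>adm_forests \<epsilon> (indices \<beta>).
          mfps_coeff f a $ j * (mbinom a \<beta> * prod_list (map ?val ts)))"
      unfolding sum_adm_trees_root
      by (intro sum.cong refl) (simp add: adm_forests_line_labels)
    also have "\<dots> = (\<Sum>a | 2 \<le> msize a \<and> msize a \<le> msize \<gamma>.
        mfps_coeff (mfps_monom (mfps_id + ?H) a) \<gamma> * mfps_coeff f a $ j)"
      by (simp add: coeff_mfps_monom_id_add powers sum_distrib_left mult_ac)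
    also have "\<dots> = mfps_coeff (mfps_compose f (mfps_id + ?H)) \<gamma> $ j"
      by (rule coeff_compose [OF f H1, symmetric])
    finally show ?thesis .
  qed
  then show ?thesis
    by (intro mfps_eqI) (simp add: vec_eq_iff)
qed

theorem proposition5p1:
  fixes \<omega> :: "complex ^ 'n::{finite, linorder}"
    and A :: "complex ^ 'n::{finite, linorder} ^ 'n::{finite, linorder}"
    and f :: "(complex ^ 'n::{finite, linorder}, 'n) mfps"
  assumes "A = diag \<omega>" and "invertible A" and "\<not> resonant \<omega>"
    and "f \<in> V_above 1"
  shows "(\<exists>!h. h \<in> V_above 1 \<and> h = D_inv \<omega> (mfps_compose f (mfps_id + h))) \<and>
    (\<forall>h. h \<in> V_above 1 \<and> h = D_inv \<omega> (mfps_compose f (mfps_id + h)) \<longrightarrow>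
      (\<forall>\<alpha> j. msize \<alpha> \<ge> 2 \<longrightarrow>
        mfps_coeff h \<alpha> $ j =
          (\<Sum>N = 1..msize \<alpha> - 1. \<Sum>\<theta>\<in>trees N \<alpha> j. tree_value \<omega> f \<theta>)))"
proof -
  let ?sol = "\<lambda>h. h \<in> V_above 1 \<and> h = D_inv \<omega> (mfps_compose f (mfps_id + h))"
  have V: "h \<in> V_above 1 \<longleftrightarrow> vanish_below 2 h" for h :: "(complex ^ 'n::{finite, linorder}, 'n) mfps"
    by (simp add: V_above_iff numeral_2_eq_2)
  have f: "vanish_below 2 f"
    using assms(4) V by simp
  have "h = D_inv \<omega> (mfps_compose f (mfps_id + h)) \<longleftrightarrow>
      D_op \<omega> h = mfps_compose f (mfps_id + h)" if "vanish_below 2 h" for h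
    using that compose_in_V_above [OF f vanish_below_mono [OF that]]
    by (intro eq_D_inv_iff assms(3)) (simp_all add: V del: One_nat_def)
  then have sol: "?sol h \<longleftrightarrow> h = tree_series \<omega> f" for h
    using solution_unique [OF assms(3) f] D_op_tree_series [OF assms(3) f]
      vanish_below_tree_series [of \<omega> f] V by metis
  then show ?thesis
    by (simp add: sum_tree_value coeff_tree_series del: One_nat_def)
qed

end
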